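(* Let $L$ be a finite-dimensional real vector space, let $G\subset L$ be a subgroup of the additive group of $L$, and let $\succ$ be a total order on $G$ compatible with addition, defined by the semigroup $G_+=\{a\in G: a\succ 0\}$. Then $\succ$ is induced by the lexicographic order $\succ_{\mathbf{x}}$ on $L$ related to some coordinate system $\mathbf{x}$ on $L$ if and only if the convex hull $\Delta(G_+)\subset L$ of the set $G_+$ does not contain the origin.
   Context: A total order is understood as a strict total order. A total order $\succ$ on a commutative group $G$ is compatible with addition if for all $x,y,a\in G$ with $x\succ y$ one has $x+a\succ y+a$; such an order is determined by $G_+$ via $x\succ y\Leftrightarrow x-y\in G_+$. $\Delta(A)$ denotes the convex hull of $A$ (the smallest convex set containing $A$, not necessarily closed). A coordinate system $\mathbf{x}=(x_1,\dots,x_n)$ on an $n$-dimensional real vector space $L$ is the ordered tuple of coordinate functions associated with an ordered basis of $L$. The lexicographic order $\succ_{\mathbf{x}}$ related to $\mathbf{x}$ is: for distinct $a,b\in L$, $a\succ_{\mathbf{x}} b$ if and only if $x_i(a)>x_i(b)$, where $i$ is the smallest index with $x_i(a)\neq x_i(b)$. An order on a subset of $L$ is induced by $\succ_{\mathbf{x}}$ if it is the restriction of $\succ_{\mathbf{x}}$. *)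

theory Defs
  imports "HOL-Analysis.Analysis"
begin

definition add_subgroup :: "'a::ab_group_add set \<Rightarrow> bool" where
  "add_subgroup G \<longleftrightarrow> 0 \<in> G \<and> (\<forall>a\<in>G. \<forall>b\<in>G. a + b \<in> G) \<and> (\<forall>a\<in>G. - a \<in> G)"

text \<open>In all notions below an order on \<open>G\<close> is a predicate \<open>gt\<close> on the whole type (\<open>gt x y\<close>
  is read ``x is greater than y''), of which only the values on \<open>G\<close> matter.\<close>

definition strict_total_order_on :: "'a set \<Rightarrow> ('a \<Rightarrow> 'a \<Rightarrow> bool) \<Rightarrow> bool" where
  "strict_total_order_on G gt \<longleftrightarrow> irreflp_on G gt \<and> transp_on G gt \<and> totalp_on G gt"

definition add_compatible_on :: "'a::ab_group_add set \<Rightarrow> ('a \<Rightarrow> 'a \<Rightarrow> bool) \<Rightarrow> bool" where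
  "add_compatible_on G gt \<longleftrightarrow> (\<forall>x\<in>G. \<forall>y\<in>G. \<forall>a\<in>G. gt x y \<longrightarrow> gt (x + a) (y + a))"

definition positive_part :: "'a::ab_group_add set \<Rightarrow> ('a \<Rightarrow> 'a \<Rightarrow> bool) \<Rightarrow> 'a set" where
  "positive_part G gt = {a \<in> G. gt a 0}"

definition finite_dim_subspace :: "'a::real_vector set \<Rightarrow> bool" where
  "finite_dim_subspace L \<longleftrightarrow> subspace L \<and> (\<exists>B. finite B \<and> span B = L)"

definition ordered_basis :: "'a::real_vector set \<Rightarrow> 'a list \<Rightarrow> bool" where
  "ordered_basis L bs \<longleftrightarrow> distinct bs \<and> independent (set bs) \<and> span (set bs) = L"

text \<open>The tuple is a list, indexed from 0; its length is \<open>dim L\<close>, possibly 0.\<close>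

definition coordinate_system :: "'a::real_vector set \<Rightarrow> ('a \<Rightarrow> real) list \<Rightarrow> bool" where
  "coordinate_system L xs \<longleftrightarrow>
     (\<exists>bs. ordered_basis L bs \<and> xs = map (\<lambda>b v. representation (set bs) v b) bs)"

definition lex_gt :: "('a \<Rightarrow> real) list \<Rightarrow> 'a \<Rightarrow> 'a \<Rightarrow> bool" where
  "lex_gt xs a b \<longleftrightarrow>
     (\<exists>i < length xs. (\<forall>j < i. (xs ! j) a = (xs ! j) b) \<and> (xs ! i) a > (xs ! i) b)"

definition induced_on :: "'a set \<Rightarrow> ('a \<Rightarrow> 'a \<Rightarrow> bool) \<Rightarrow> ('a \<Rightarrow> 'a \<Rightarrow> bool) \<Rightarrow> bool" where
  "induced_on G gt gt' \<longleftrightarrow> (\<forall>a\<in>G. \<forall>b\<in>G. gt a b \<longleftrightarrow> gt' a b)"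

end

theory Submission
  imports Defs
begin

text \<open>A convex set avoiding the origin generates a convex cone avoiding the origin, and by Zorn's
  lemma this cone is contained in the positive cone \<open>P\<close> of a total vector space order on \<open>L\<close>.
  Such an order has an order unit \<open>u\<close>, and \<open>v\<close> mapped to the cut
  \<open>sup {t. v - t u \<in> P}\<close> is a linear functional, nonnegative on \<open>P\<close> and with value 1 at \<open>u\<close>:
  this is the first coordinate. Its kernel carries the order with positive cone
  \<open>P\<close> intersected with the kernel, and induction on the dimension gives the other coordinates.
  This argument is purely algebraic, so \<open>L\<close> needs no topology.\<close>

section \<open>Cones of positive vectors and their extension to total cones\<close>

text \<open>The positive vectors of a strict partial vector space order, where \<open>x\<close>
  exceeds \<open>y\<close> if \<open>x - y \<in> P\<close>. Strictness is why the origin is excluded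
  and only positive scalars act. The empty set is allowed.\<close>

definition pointed_cone :: "'a::real_vector set \<Rightarrow> bool" where
  "pointed_cone P \<longleftrightarrow> 0 \<notin> P \<and> (\<forall>x\<in>P. \<forall>y\<in>P. x + y \<in> P) \<and> (\<forall>x\<in>P. \<forall>t>0. t *\<^sub>R x \<in> P)"

text \<open>The order given by \<open>P\<close> compares any two distinct vectors of a subspace
  \<open>L\<close>. There \<open>P\<close> can be empty only for \<open>L = {0}\<close>, which is
  the base case of the later induction.\<close>

definition total_cone :: "'a::real_vector set \<Rightarrow> 'a set \<Rightarrow> bool" where
  "total_cone L P \<longleftrightarrow> pointed_cone P \<and> P \<subseteq> L \<and> (\<forall>v\<in>L. v = 0 \<or> v \<in> P \<or> - v \<in> P)"

lemma pointed_coneD: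
  assumes "pointed_cone P"
  shows "0 \<notin> P" "x \<in> P \<Longrightarrow> y \<in> P \<Longrightarrow> x + y \<in> P" "x \<in> P \<Longrightarrow> t > 0 \<Longrightarrow> t *\<^sub>R x \<in> P"
  using assms by (auto simp: pointed_cone_def)

lemma pointed_cone_not_both:
  assumes "pointed_cone P" "x \<in> P" shows "- x \<notin> P"
  using pointed_coneD(1,2)[OF assms(1)] assms(2) by (metis add.right_inverse)

text \<open>A sum of positive multiples of points of \<open>C\<close> is, after division by the
  total weight \<open>s + t\<close>, a convex combination of these points, hence again a positive
  multiple of a point of \<open>C\<close>.\<close>

lemma pointed_cone_generated:
  assumes "convex C" "0 \<notin> C"
  shows "pointed_cone {t *\<^sub>R c |t c. t > 0 \<and> c \<in> C}"
  unfolding pointed_cone_def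
proof (intro conjI ballI allI impI)
  show "0 \<notin> {t *\<^sub>R c |t c. t > 0 \<and> c \<in> C}"
    using assms(2) by auto
next
  fix x y
  assume "x \<in> {t *\<^sub>R c |t c. t > 0 \<and> c \<in> C}" "y \<in> {t *\<^sub>R c |t c. t > 0 \<and> c \<in> C}"
  then obtain s c t d where *: "x = s *\<^sub>R c" "s > 0" "c \<in> C" "y = t *\<^sub>R d" "t > 0" "d \<in> C"
    by blast
  have "(s / (s + t)) *\<^sub>R c + (t / (s + t)) *\<^sub>R d \<in> C"
    using * by (intro convexD[OF assms(1)]) (auto simp: add_divide_distrib[symmetric])
  moreover have "x + y = (s + t) *\<^sub>R ((s / (s + t)) *\<^sub>R c + (t / (s + t)) *\<^sub>R d)"
    using * by (simp add: scaleR_add_right)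
  ultimately show "x + y \<in> {t *\<^sub>R c |t c. t > 0 \<and> c \<in> C}"
    using * by (metis (mono_tags, lifting) add_pos_pos mem_Collect_eq)
next
  fix x and r :: real
  assume "x \<in> {t *\<^sub>R c |t c. t > 0 \<and> c \<in> C}" "r > 0"
  then obtain s c where "x = s *\<^sub>R c" "s > 0" "c \<in> C" by blast
  then have "r *\<^sub>R x = (r * s) *\<^sub>R c" "r * s > 0" using \<open>r > 0\<close> by auto
  then show "r *\<^sub>R x \<in> {t *\<^sub>R c |t c. t > 0 \<and> c \<in> C}" using \<open>c \<in> C\<close> by blast
qed

text \<open>If the new cone contained 0, say \<open>0 = p + t *\<^sub>R v\<close>, then either
  \<open>p = 0\<close> and \<open>v = 0\<close>, or \<open>- v\<close> is the positive multiple
  \<open>(1 / t) *\<^sub>R p\<close> of an element of \<open>P\<close>. Both are excluded. Taking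
  \<open>p\<close> from \<open>insert 0 P\<close> puts the ray of \<open>v\<close> itself into the
  cone.\<close>

lemma pointed_cone_adjoin:
  assumes P: "pointed_cone P" and v: "v \<noteq> 0" "- v \<notin> P"
  shows "pointed_cone (P \<union> {p + t *\<^sub>R v |p t. t > 0 \<and> p \<in> insert 0 P})" (is "pointed_cone (P \<union> ?Q)")
  unfolding pointed_cone_def
proof (intro conjI ballI allI impI)
  show "0 \<notin> P \<union> ?Q"
  proof
    assume "0 \<in> P \<union> ?Q"
    then obtain p t where pt: "0 = p + t *\<^sub>R v" "t > 0" "p \<in> insert 0 P"
      using pointed_coneD(1)[OF P] by blast
    then have "p \<in> P" using v(1) by auto
    then have "(1 / t) *\<^sub>R p \<in> P" using pt(2) by (intro pointed_coneD(3)[OF P]) auto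
    moreover have "p = - (t *\<^sub>R v)" using pt(1) by (simp add: eq_neg_iff_add_eq_0)
    then have "(1 / t) *\<^sub>R p = - v" using pt(2) by simp
    ultimately show False using v(2) by simp
  qed
next
  have add0: "p + q \<in> insert 0 P" if "p \<in> insert 0 P" "q \<in> insert 0 P" for p q
    using that pointed_coneD(2)[OF P] by auto
  fix x y
  assume "x \<in> P \<union> ?Q" "y \<in> P \<union> ?Q"
  then consider "x \<in> P" "y \<in> P"
    | p t where "x \<in> P" "y = p + t *\<^sub>R v" "t > 0" "p \<in> insert 0 P"
    | p t where "y \<in> P" "x = p + t *\<^sub>R v" "t > 0" "p \<in> insert 0 P"
    | p t q s where "x = p + t *\<^sub>R v" "t > 0" "p \<in> insert 0 P"
        "y = q + s *\<^sub>R v" "s > 0" "q \<in> insert 0 P"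
    by blast
  then show "x + y \<in> P \<union> ?Q"
  proof cases
    case 1
    then show ?thesis using pointed_coneD(2)[OF P] by simp
  next
    case (2 p t)
    then have "x + y = (x + p) + t *\<^sub>R v" "x + p \<in> insert 0 P" using add0 by auto
    then show ?thesis using 2 by blast
  next
    case (3 p t)
    then have "x + y = (p + y) + t *\<^sub>R v" "p + y \<in> insert 0 P" using add0 by auto
    then show ?thesis using 3 by blast
  next
    case (4 p t q s)
    then have "x + y = (p + q) + (t + s) *\<^sub>R v" "p + q \<in> insert 0 P" "t + s > 0"
      using add0 by (auto simp: scaleR_add_left)
    then show ?thesis by blast
  qed
next
  fix x and r :: real
  assume x: "x \<in> P \<union> ?Q" and r: "r > 0"
  show "r *\<^sub>R x \<in> P \<union> ?Q"
  proof (cases "x \<in> P")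
    case True
    then show ?thesis using pointed_coneD(3)[OF P] r by simp
  next
    case False
    then obtain p t where pt: "x = p + t *\<^sub>R v" "t > 0" "p \<in> insert 0 P" using x by blast
    then have "r *\<^sub>R x = r *\<^sub>R p + (r * t) *\<^sub>R v" "r * t > 0" "r *\<^sub>R p \<in> insert 0 P"
      using r pointed_coneD(3)[OF P] by (auto simp: scaleR_add_right)
    then show ?thesis by blast
  qed
qed

lemma total_cone_extension:
  assumes L: "subspace L" and C: "convex C" "0 \<notin> C" "C \<subseteq> L"
  shows "\<exists>P. total_cone L P \<and> C \<subseteq> P"
proof -
  define A where "A = {P. pointed_cone P \<and> P \<subseteq> L \<and> C \<subseteq> P}"
  have "{t *\<^sub>R c |t c. t > 0 \<and> c \<in> C} \<in> A"
  proof -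
    have "c \<in> {t *\<^sub>R c |t c. t > 0 \<and> c \<in> C}" if "c \<in> C" for c
      using that by (auto intro!: exI[of _ 1] exI[of _ c])
    then show ?thesis
      using pointed_cone_generated[OF C(1,2)] C(3) subspace_scale[OF L]
      unfolding A_def by blast
  qed
  then have "A \<noteq> {}" by blast
  \<comment> \<open>Any two elements of the union lie in a common member of the chain, so closure
    under addition passes to the union.\<close>
  moreover have "\<Union>\<C> \<in> A" if ne: "\<C> \<noteq> {}" and chain: "subset.chain A \<C>" for \<C>
  proof -
    have sub: "pointed_cone P" "P \<subseteq> L" "C \<subseteq> P" if "P \<in> \<C>" for P
      using that chain by (auto simp: A_def subset_chain_def)
    have "x + y \<in> \<Union>\<C>" if xy: "x \<in> \<Union>\<C>" "y \<in> \<Union>\<C>" for x y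
    proof -
      obtain P where "P \<in> \<C>" "x \<in> P" "y \<in> P"
        using xy chain unfolding subset_chain_def by blast
      then show ?thesis using pointed_coneD(2)[OF sub(1)] by blast
    qed
    moreover have "0 \<notin> \<Union>\<C>" using pointed_coneD(1)[OF sub(1)] by blast
    moreover have "t *\<^sub>R x \<in> \<Union>\<C>" if "x \<in> \<Union>\<C>" "t > 0" for x and t :: real
      using that pointed_coneD(3)[OF sub(1)] by blast
    ultimately have "pointed_cone (\<Union>\<C>)" unfolding pointed_cone_def by blast
    then show ?thesis unfolding A_def using sub(2,3) ne by blast
  qed
  ultimately obtain P where "P \<in> A" and max: "\<And>X. X \<in> A \<Longrightarrow> P \<subseteq> X \<Longrightarrow> X = P"
    using subset_Zorn_nonempty[of A] by blast
  then have P: "pointed_cone P" "P \<subseteq> L" "C \<subseteq> P" by (auto simp: A_def)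
  \<comment> \<open>Totality from maximality: \<open>v\<close> can be adjoined to \<open>P\<close>,
    so it belongs to \<open>P\<close> already.\<close>
  have "v \<in> P" if v: "v \<in> L" "v \<noteq> 0" "- v \<notin> P" for v
  proof -
    let ?Q = "{p + t *\<^sub>R v |p t. t > 0 \<and> p \<in> insert 0 P}"
    have "?Q \<subseteq> L"
      using P(2) v(1) subspace_add[OF L] subspace_scale[OF L] subspace_0[OF L] by blast
    then have "P \<union> ?Q \<in> A"
      unfolding A_def using pointed_cone_adjoin[OF P(1) v(2,3)] P by blast
    then have "P \<union> ?Q = P" using max by blast
    moreover have "v = 0 + 1 *\<^sub>R v" by simp
    then have "v \<in> ?Q" using zero_less_one by blast
    ultimately show ?thesis by blast
  qed
  then show ?thesis using P unfolding total_cone_def by blast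
qed

section \<open>Order units and the leading linear functional\<close>

text \<open>One vector \<open>b\<close> is treated at a time. If \<open>c\<close> is the positive
  one of \<open>b\<close> and \<open>- b\<close>, then adding \<open>c\<close> twice to the old
  bound \<open>u\<close> preserves the old bounds, and adding or subtracting \<open>b\<close>
  afterwards leaves \<open>u\<close> plus one or three copies of \<open>c\<close>.\<close>

lemma total_cone_bound_finite:
  assumes P: "total_cone L P" "P \<noteq> {}" and F: "finite F" "F \<subseteq> L"
  shows "\<exists>u\<in>P. \<forall>b\<in>F. u - b \<in> P \<and> u + b \<in> P"
  using F
proof (induction F rule: finite_induct)
  case empty
  then show ?case using P(2) by blast
next
  case (insert b F)
  have cone: "pointed_cone P" using P(1) by (simp add: total_cone_def)
  note add = pointed_coneD(2)[OF cone]
  from insert obtain u where u: "u \<in> P" "\<And>b. b \<in> F \<Longrightarrow> u - b \<in> P \<and> u + b \<in> P" by auto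
  have "b = 0 \<or> b \<in> P \<or> - b \<in> P" using insert.prems P(1) by (simp add: total_cone_def)
  then consider "b = 0" | c where "c \<in> P" "b = c \<or> b = - c" by (metis minus_minus)
  then show ?case
  proof cases
    case 1
    then show ?thesis using u by auto
  next
    case (2 c)
    have "u + c + c - x \<in> P \<and> u + c + c + x \<in> P" if "x \<in> F" for x
    proof -
      have "u + c + c - x = (u - x) + c + c" "u + c + c + x = (u + x) + c + c" by auto
      then show ?thesis using u(2)[OF that] 2(1) add by presburger
    qed
    moreover have "u + c + c - b \<in> P \<and> u + c + c + b \<in> P"
      using 2 u(1) add by auto
    moreover have "u + c + c \<in> P" using 2 u(1) add by auto
    ultimately show ?thesis by blast
  qed
qed

text \<open>The vectors between two opposite multiples of \<open>u\<close> form a subspace. If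
  \<open>u\<close> bounds a finite spanning set, this subspace contains all of
  \<open>L\<close>.\<close>

lemma total_cone_order_unit:
  assumes P: "total_cone L P" "P \<noteq> {}" and B: "finite B" "span B = L"
  shows "\<exists>u\<in>P. \<forall>v\<in>L. \<exists>t. t *\<^sub>R u - v \<in> P \<and> t *\<^sub>R u + v \<in> P"
proof -
  have cone: "pointed_cone P" using P(1) by (simp add: total_cone_def)
  note add = pointed_coneD(2)[OF cone] and scale = pointed_coneD(3)[OF cone]
  obtain u where u: "u \<in> P" "\<And>b. b \<in> B \<Longrightarrow> u - b \<in> P \<and> u + b \<in> P"
    using total_cone_bound_finite[OF P B(1)] B(2) span_superset by blast
  define S where "S = {v. \<exists>t. t *\<^sub>R u - v \<in> P \<and> t *\<^sub>R u + v \<in> P}"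
  have "subspace S"
  proof (rule subspaceI)
    show "0 \<in> S" unfolding S_def using u(1) by (auto intro!: exI[of _ 1])
  next
    fix x y assume "x \<in> S" "y \<in> S"
    then obtain s t where st: "s *\<^sub>R u - x \<in> P" "s *\<^sub>R u + x \<in> P" "t *\<^sub>R u - y \<in> P" "t *\<^sub>R u + y \<in> P"
      unfolding S_def by blast
    have "(s + t) *\<^sub>R u - (x + y) \<in> P" "(s + t) *\<^sub>R u + (x + y) \<in> P"
      using add[OF st(1,3)] add[OF st(2,4)] by (simp_all add: algebra_simps)
    then show "x + y \<in> S" unfolding S_def by blast
  next
    fix c :: real and x assume x: "x \<in> S"
    then obtain s where s: "s *\<^sub>R u - x \<in> P" "s *\<^sub>R u + x \<in> P" unfolding S_def by blast
    show "c *\<^sub>R x \<in> S"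
    proof (cases c "0::real" rule: linorder_cases)
      \<comment> \<open>A negative factor interchanges the upper and the lower bound.\<close>
      case less
      have "(- c * s) *\<^sub>R u - c *\<^sub>R x \<in> P" "(- c * s) *\<^sub>R u + c *\<^sub>R x \<in> P"
        using scale[OF s(2), of "- c"] scale[OF s(1), of "- c"] less
        by (simp_all add: scaleR_add_right scaleR_diff_right)
      then show ?thesis unfolding S_def by blast
    next
      case equal
      then show ?thesis unfolding S_def using u(1) by (auto intro!: exI[of _ 1])
    next
      case greater
      have "(c * s) *\<^sub>R u - c *\<^sub>R x \<in> P" "(c * s) *\<^sub>R u + c *\<^sub>R x \<in> P"
        using scale[OF s(1), of c] scale[OF s(2), of c] greater
        by (simp_all add: scaleR_add_right scaleR_diff_right)
      then show ?thesis unfolding S_def by blast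
    qed
  qed
  moreover have "B \<subseteq> S" unfolding S_def using u(2) by (auto intro!: exI[of _ 1])
  ultimately have "L \<subseteq> S" using B(2) span_minimal by blast
  then show ?thesis using u(1) unfolding S_def by blast
qed

text \<open>Linearity follows from uniqueness of cuts: the expected value is checked to be a cut. On
  \<open>P\<close> only \<open>f v \<ge> 0\<close> can hold in general, since a positive
  \<open>v\<close> may be infinitesimal relative to \<open>u\<close>.\<close>

lemma total_cone_functional:
  assumes P: "total_cone L P" "P \<noteq> {}" and B: "finite B" "span B = L"
  shows "\<exists>u f. u \<in> P \<and> f u = (1::real) \<and> (\<forall>v\<in>P. f v \<ge> 0)
    \<and> (\<forall>v\<in>L. \<forall>w\<in>L. f (v + w) = f v + f w) \<and> (\<forall>v\<in>L. \<forall>c. f (c *\<^sub>R v) = c * f v)"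
proof -
  have cone: "pointed_cone P" and PL: "P \<subseteq> L"
    and total: "\<And>v. v \<in> L \<Longrightarrow> v = 0 \<or> v \<in> P \<or> - v \<in> P"
    using P(1) by (auto simp: total_cone_def)
  note add = pointed_coneD(2)[OF cone] and scale = pointed_coneD(3)[OF cone]
  have L: "subspace L" using B(2) by auto
  obtain u where u: "u \<in> P" and unit: "\<And>v. v \<in> L \<Longrightarrow> \<exists>t. t *\<^sub>R u - v \<in> P \<and> t *\<^sub>R u + v \<in> P"
    using total_cone_order_unit[OF P B] by blast
  \<comment> \<open>Nothing is required at \<open>t = g\<close>: the difference
    \<open>v - g *\<^sub>R u\<close> may be 0 or an infinitesimal of either sign.\<close>
  define cut where "cut v g \<longleftrightarrow> (\<forall>t<g. v - t *\<^sub>R u \<in> P) \<and> (\<forall>t>g. t *\<^sub>R u - v \<in> P)" for v g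
  have cut_unique: "g = h" if "cut v g" "cut v h" for v g h
  proof -
    \<comment> \<open>A number \<open>t\<close> strictly between two cuts would make
      \<open>v - t *\<^sub>R u\<close> and its negative both positive.\<close>
    have "\<not> a < b" if ab: "cut v a" "cut v b" for a b
    proof
      assume "a < b"
      then obtain t where "a < t" "t < b" using dense by blast
      then have "v - t *\<^sub>R u \<in> P" "t *\<^sub>R u - v \<in> P" using ab unfolding cut_def by auto
      then show False using pointed_cone_not_both[OF cone] by (metis minus_diff_eq)
    qed
    then show ?thesis using that by (metis linorder_neqE)
  qed
  have "\<exists>g. cut v g" if v: "v \<in> L" for v
  proof -
    define T where "T = {t. v - t *\<^sub>R u \<in> P}"
    obtain s where s: "s *\<^sub>R u - v \<in> P" "s *\<^sub>R u + v \<in> P" using unit[OF v] by blast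
    have mono: "v - r *\<^sub>R u \<in> P" if "v - t *\<^sub>R u \<in> P" "r < t" for r t
    proof -
      have "v - r *\<^sub>R u = (v - t *\<^sub>R u) + (t - r) *\<^sub>R u" by (simp add: algebra_simps)
      moreover have "(t - r) *\<^sub>R u \<in> P" using that(2) by (intro scale u) simp
      ultimately show ?thesis using add that(1) by metis
    qed
    \<comment> \<open>The two bounds from the order unit show that \<open>T\<close> contains
      \<open>- s\<close> and is bounded above by \<open>s\<close>, so \<open>Sup T\<close> is a
      genuine supremum.\<close>
    have "v - (- s) *\<^sub>R u \<in> P" using s(2) by (simp add: add.commute)
    then have ne: "T \<noteq> {}" unfolding T_def by blast
    have "t \<le> s" if "t \<in> T" for t
    proof (rule ccontr)
      assume "\<not> t \<le> s"
      then have "v - s *\<^sub>R u \<in> P" using that mono unfolding T_def by auto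
      then show False using s(1) pointed_cone_not_both[OF cone] by (metis minus_diff_eq)
    qed
    then have bdd: "bdd_above T" by (auto simp: bdd_above_def)
    have "v - t *\<^sub>R u \<in> P" if "t < Sup T" for t
      using that mono less_cSup_iff[OF ne bdd] unfolding T_def by blast
    moreover have "t *\<^sub>R u - v \<in> P" if t: "t > Sup T" for t
    proof -
      \<comment> \<open>Since \<open>r\<close> is outside \<open>T\<close>, totality gives only that
        \<open>v\<close> does not exceed \<open>r *\<^sub>R u\<close>, with equality possible. The
        surplus \<open>(t - r) *\<^sub>R u\<close> makes the comparison with
        \<open>t *\<^sub>R u\<close> strict.\<close>
      obtain r where r: "Sup T < r" "r < t" using t dense by blast
      then have "r \<notin> T" using cSup_upper[OF _ bdd] by force
      moreover have "v - r *\<^sub>R u \<in> L"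
        using v u PL by (intro subspace_diff[OF L] subspace_scale[OF L]) auto
      ultimately have "v - r *\<^sub>R u = 0 \<or> r *\<^sub>R u - v \<in> P"
        using total[of "v - r *\<^sub>R u"] unfolding T_def by auto
      moreover have "(t - r) *\<^sub>R u \<in> P" using r u scale by auto
      moreover have "t *\<^sub>R u - v = (r *\<^sub>R u - v) + (t - r) *\<^sub>R u"
        "v - r *\<^sub>R u = 0 \<Longrightarrow> t *\<^sub>R u - v = (t - r) *\<^sub>R u"
        by (simp_all add: algebra_simps)
      ultimately show ?thesis using add by metis
    qed
    ultimately show ?thesis unfolding cut_def by blast
  qed
  then obtain f where f: "\<And>v. v \<in> L \<Longrightarrow> cut v (f v)" by metis
  have f_eq: "f v = g" if "v \<in> L" "cut v g" for v g using that f cut_unique by blast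
  have "f u = 1"
  proof (rule f_eq)
    show "u \<in> L" using u PL by blast
    have "u - t *\<^sub>R u = (1 - t) *\<^sub>R u" "t *\<^sub>R u - u = (t - 1) *\<^sub>R u" for t
      by (simp_all add: algebra_simps)
    then show "cut u 1" unfolding cut_def using scale[OF u] by simp
  qed
  moreover have "f v \<ge> 0" if "v \<in> P" for v
  proof (rule ccontr)
    assume "\<not> f v \<ge> 0"
    \<comment> \<open>A negative cut lies below \<open>t = 0\<close>, which would make
      \<open>- v\<close> positive.\<close>
    then have "0 *\<^sub>R u - v \<in> P" using f[of v] that PL unfolding cut_def by (meson not_le subsetD)
    then show False using that pointed_cone_not_both[OF cone] by simp
  qed
  moreover have "f (v + w) = f v + f w" if vw: "v \<in> L" "w \<in> L" for v w
  proof (rule f_eq)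
    show "v + w \<in> L" using vw subspace_add[OF L] by blast
    note cv = f[OF vw(1), unfolded cut_def] and cw = f[OF vw(2), unfolded cut_def]
    \<comment> \<open>The signed gap between \<open>t\<close> and \<open>f v + f w\<close> is shared
      equally: \<open>f v + e\<close> and \<open>f w + e\<close> sum to \<open>t\<close>, and each
      lies strictly on the same side of its own cut as \<open>t\<close> does of the sum.\<close>
    have split: "(v + w) - t *\<^sub>R u = (v - (f v + e) *\<^sub>R u) + (w - (f w + e) *\<^sub>R u)"
      "t *\<^sub>R u - (v + w) = ((f v + e) *\<^sub>R u - v) + ((f w + e) *\<^sub>R u - w)"
      if "e = (t - (f v + f w)) / 2" for t e
    proof -
      have "t = (f v + e) + (f w + e)" using that by (simp add: field_simps)
      then show "(v + w) - t *\<^sub>R u = (v - (f v + e) *\<^sub>R u) + (w - (f w + e) *\<^sub>R u)"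
        "t *\<^sub>R u - (v + w) = ((f v + e) *\<^sub>R u - v) + ((f w + e) *\<^sub>R u - w)"
        by (simp_all only: scaleR_add_left) simp_all
    qed
    show "cut (v + w) (f v + f w)"
      unfolding cut_def
    proof (intro conjI allI impI)
      fix t assume "t < f v + f w"
      then have "v - (f v + (t - (f v + f w)) / 2) *\<^sub>R u \<in> P" "w - (f w + (t - (f v + f w)) / 2) *\<^sub>R u \<in> P"
        using cv cw by auto
      then show "v + w - t *\<^sub>R u \<in> P" using add split(1)[OF refl, of t] by metis
    next
      fix t assume "f v + f w < t"
      then have "(f v + (t - (f v + f w)) / 2) *\<^sub>R u - v \<in> P" "(f w + (t - (f v + f w)) / 2) *\<^sub>R u - w \<in> P"
        using cv cw by auto
      then show "t *\<^sub>R u - (v + w) \<in> P" using add split(2)[OF refl, of t] by metis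
    qed
  qed
  moreover have "f (c *\<^sub>R v) = c * f v" if v: "v \<in> L" for v c
  proof (rule f_eq)
    show "c *\<^sub>R v \<in> L" using v subspace_scale[OF L] by blast
    note cv = f[OF v, unfolded cut_def]
    show "cut (c *\<^sub>R v) (c * f v)"
    proof (cases c "0::real" rule: linorder_cases)
      case less
      \<comment> \<open>Dividing by a negative \<open>c\<close> reverses the order, so the lower
        half of the cut for \<open>c *\<^sub>R v\<close> comes from the upper half of the cut for
        \<open>v\<close>, and conversely.\<close>
      have *: "c *\<^sub>R v - t *\<^sub>R u = (- c) *\<^sub>R ((t / c) *\<^sub>R u - v)"
        "t *\<^sub>R u - c *\<^sub>R v = (- c) *\<^sub>R (v - (t / c) *\<^sub>R u)" for t
        using less by (simp_all add: scaleR_diff_right)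
      have "t / c > f v" if "t < c * f v" for t using that less by (simp add: field_simps)
      moreover have "t / c < f v" if "t > c * f v" for t using that less by (simp add: field_simps)
      ultimately show ?thesis
        unfolding cut_def * using cv less by (intro conjI allI impI scale) simp_all
    next
      case equal
      have "t < 0 \<Longrightarrow> (- t) *\<^sub>R u \<in> P" "t > 0 \<Longrightarrow> t *\<^sub>R u \<in> P" for t using scale[OF u] by (simp_all del: scaleR_minus_left)
      then show ?thesis using equal by (simp add: cut_def)
    next
      case greater
      have *: "c *\<^sub>R v - t *\<^sub>R u = c *\<^sub>R (v - (t / c) *\<^sub>R u)"
        "t *\<^sub>R u - c *\<^sub>R v = c *\<^sub>R ((t / c) *\<^sub>R u - v)" for t
        using greater by (simp_all add: scaleR_diff_right)
      have "t / c < f v" if "t < c * f v" for t using that greater by (simp add: field_simps)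
      moreover have "t / c > f v" if "t > c * f v" for t using that greater by (simp add: field_simps)
      ultimately show ?thesis
        unfolding cut_def * using cv greater by (intro conjI allI impI scale) simp_all
    qed
  qed
  ultimately show ?thesis using u by blast
qed

section \<open>The lexicographic order on lists of functions\<close>

text \<open>Turns the search for the first differing index into a recursion, so that the facts below
  can be proved by induction on the list.\<close>

lemma lex_gt_Cons:
  "lex_gt (x # xs) a b \<longleftrightarrow> x a > x b \<or> x a = x b \<and> lex_gt xs a b"
proof
  assume "lex_gt (x # xs) a b"
  then obtain i where i: "i < length (x # xs)" "\<forall>j<i. ((x # xs) ! j) a = ((x # xs) ! j) b"
    "((x # xs) ! i) a > ((x # xs) ! i) b"
    unfolding lex_gt_def by blast
  show "x a > x b \<or> x a = x b \<and> lex_gt xs a b"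
  proof (cases i)
    case 0
    then show ?thesis using i by simp
  next
    case (Suc k)
    then have "x a = x b" "k < length xs" "(xs ! k) a > (xs ! k) b"
      "\<forall>j<k. (xs ! j) a = (xs ! j) b"
      using i by (auto dest: spec[of _ 0] spec[of _ "Suc _"])
    then show ?thesis unfolding lex_gt_def by blast
  qed
next
  assume "x a > x b \<or> x a = x b \<and> lex_gt xs a b"
  then show "lex_gt (x # xs) a b"
  proof
    assume "x a > x b"
    then show ?thesis unfolding lex_gt_def by (intro exI[of _ 0]) auto
  next
    assume *: "x a = x b \<and> lex_gt xs a b"
    then obtain i where "i < length xs" "\<forall>j<i. (xs ! j) a = (xs ! j) b" "(xs ! i) a > (xs ! i) b"
      unfolding lex_gt_def by blast
    then show ?thesis
      using * unfolding lex_gt_def by (intro exI[of _ "Suc i"]) (auto simp: less_Suc_eq_0_disj)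
  qed
qed

lemma lex_gt_Nil [simp]: "\<not> lex_gt [] a b"
  by (simp add: lex_gt_def)

text \<open>Only differences of coordinates enter the order. For linear coordinates this gives
  translation invariance.\<close>

lemma lex_gt_cong:
  "(\<And>x. x \<in> set xs \<Longrightarrow> x a - x b = x c - x d) \<Longrightarrow> lex_gt xs a b \<longleftrightarrow> lex_gt xs c d"
proof (induction xs)
  case (Cons x xs)
  have "x a - x b = x c - x d" using Cons.prems by simp
  then have "x a > x b \<longleftrightarrow> x c > x d" "x a = x b \<longleftrightarrow> x c = x d" by linarith+
  then show ?case using Cons by (simp add: lex_gt_Cons)
qed simp

text \<open>Serves to change the basis inside the coordinate functions: each of them mentions the
  whole basis, which grows when a vector is put in front.\<close>

lemma lex_gt_map_cong:
  assumes "\<And>x. x \<in> set xs \<Longrightarrow> f x a = g x a \<and> f x b = g x b"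
  shows "lex_gt (map f xs) a b \<longleftrightarrow> lex_gt (map g xs) a b"
  using assms by (induction xs) (simp_all add: lex_gt_Cons)

lemma lex_gt_asym: "lex_gt xs a b \<Longrightarrow> \<not> lex_gt xs b a"
  by (induction xs) (auto simp: lex_gt_Cons)

text \<open>Here \<open>z\<close> stands for the origin. With positive weights the leading
  coordinate of \<open>c\<close> is positive as soon as that of \<open>a\<close> or \<open>b\<close>
  is; if both vanish, the remaining coordinates decide.\<close>

lemma lex_gt_convex_combination:
  assumes "s \<ge> 0" "t \<ge> 0" "s + t = (1::real)"
    and "\<And>x. x \<in> set xs \<Longrightarrow> x z = 0 \<and> x c = s * x a + t * x b"
    and "lex_gt xs a z" "lex_gt xs b z"
  shows "lex_gt xs c z"
  using assms(4-)
proof (induction xs)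
  case (Cons x xs)
  have x: "x z = 0" "x c = s * x a + t * x b" using Cons.prems(1) by auto
  have ge: "x a \<ge> 0" "x b \<ge> 0" using Cons.prems(2,3) x by (auto simp: lex_gt_Cons)
  show ?case
  \<comment> \<open>A zero weight could cancel the only positive leading coordinate. In that case
    \<open>c\<close> has the same coordinates as one of the endpoints.\<close>
  proof (cases "s = 0 \<or> t = 0")
    case True
    then have "s = 0 \<and> t = 1 \<or> s = 1 \<and> t = 0" using assms(3) by auto
    moreover have "y c = s * y a + t * y b" if "y \<in> set (x # xs)" for y
      using Cons.prems(1)[OF that] ..
    ultimately have "(\<forall>y\<in>set (x # xs). y c = y b) \<or> (\<forall>y\<in>set (x # xs). y c = y a)"
      by (metis add.left_neutral add.right_neutral mult_1 mult_zero_left)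
    then have "(lex_gt (x # xs) c z \<longleftrightarrow> lex_gt (x # xs) b z) \<or>
        (lex_gt (x # xs) c z \<longleftrightarrow> lex_gt (x # xs) a z)"
      using lex_gt_cong[of "x # xs" c z b z] lex_gt_cong[of "x # xs" c z a z] by metis
    then show ?thesis
      using Cons.prems(2,3) by blast
  next
    case False
    then have st: "s > 0" "t > 0" using assms by auto
    show ?thesis
    proof (cases "x a = 0 \<and> x b = 0")
      case True
      then have "lex_gt xs a z" "lex_gt xs b z" using Cons.prems(2,3) x(1) by (auto simp: lex_gt_Cons)
      then have "lex_gt xs c z" using Cons.IH Cons.prems(1) by simp
      then show ?thesis using x True by (simp add: lex_gt_Cons)
    next
      case False
      then consider "x a > 0" | "x b > 0" using ge by linarith
      then have "s * x a + t * x b > 0"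
      proof cases
        case 1
        then show ?thesis using st ge by (intro add_pos_nonneg) auto
      next
        case 2
        then show ?thesis using st ge by (intro add_nonneg_pos) auto
      qed
      then show ?thesis using x by (simp add: lex_gt_Cons)
    qed
  qed
qed simp

section \<open>A lexicographic basis for a total cone\<close>

abbreviation coords :: "'a::real_vector list \<Rightarrow> ('a \<Rightarrow> real) list" where
  "coords bs \<equiv> map (\<lambda>b v. representation (set bs) v b) bs"

text \<open>The order unit \<open>u\<close> is put in front of a basis of the kernel of
  \<open>f\<close> in \<open>L\<close>. As \<open>f u = 1\<close>, the coordinate along
  \<open>u\<close> is \<open>f\<close>. It is nonnegative on \<open>P\<close>, and where it vanishes
  the vector lies in the kernel and the induction hypothesis decides.\<close>

lemma total_cone_lex_basis:
  assumes "total_cone L P" "finite B" "span B = L"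
  shows "\<exists>bs. ordered_basis L bs \<and> (\<forall>v\<in>P. lex_gt (coords bs) v 0)"
  using assms
proof (induction "card B" arbitrary: B L P rule: less_induct)
  case less
  note P = less.prems(1) and B = less.prems(2,3)
  have cone: "pointed_cone P" and PL: "P \<subseteq> L"
    and total: "\<And>v. v \<in> L \<Longrightarrow> v = 0 \<or> v \<in> P \<or> - v \<in> P"
    using P by (auto simp: total_cone_def)
  have L: "subspace L" using B(2) by auto
  show ?case
  proof (cases "P = {}")
    \<comment> \<open>Dimension 0: the coordinate list is empty.\<close>
    case True
    then have "L = {0}" using total subspace_0[OF L] by auto
    then have "ordered_basis L []" by (simp add: ordered_basis_def independent_empty)
    then show ?thesis using True by blast
  next
    case False
    obtain u f where u: "u \<in> P" and fu: "f u = (1::real)" and f0: "\<And>v. v \<in> P \<Longrightarrow> f v \<ge> 0"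
      and f_add: "\<And>v w. v \<in> L \<Longrightarrow> w \<in> L \<Longrightarrow> f (v + w) = f v + f w"
      and f_scale: "\<And>v c. v \<in> L \<Longrightarrow> f (c *\<^sub>R v) = c * f v"
      using total_cone_functional[OF P False B] by blast
    define K where "K = {v \<in> L. f v = 0}"
    have K: "subspace K"
      unfolding K_def using f_add f_scale f_scale[OF subspace_0[OF L], of 0] L
      by (auto intro!: subspaceI simp: subspace_add subspace_scale subspace_0)
    have "K \<subseteq> L" by (auto simp: K_def)
    have "total_cone K (P \<inter> K)"
      unfolding total_cone_def
    proof (intro conjI ballI)
      show "pointed_cone (P \<inter> K)"
        using pointed_coneD[OF cone] subspace_add[OF K] subspace_scale[OF K]
        unfolding pointed_cone_def by simp
      show "v = 0 \<or> v \<in> P \<inter> K \<or> - v \<in> P \<inter> K" if "v \<in> K" for v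
        using total[of v] that subspace_neg[OF K that] \<open>K \<subseteq> L\<close> by blast
    qed simp
    obtain B' where B': "B' \<subseteq> K" "independent B'" "span B' = K"
      using basis_exists[of K] span_subspace[OF _ _ K] by metis
    have uL: "u \<in> L" using u PL by blast
    have uK: "u \<notin> K" using fu by (simp add: K_def)
    \<comment> \<open>The extra independent vector \<open>u\<close> makes \<open>card B'\<close>
      strictly smaller than \<open>card B\<close>, so the induction hypothesis applies to the
      kernel.\<close>
    have "independent (insert u B')" using B' uK by (simp add: independent_insert)
    moreover have "insert u B' \<subseteq> span B" using B'(1) \<open>K \<subseteq> L\<close> uL B(2) by simp
    ultimately have "finite (insert u B') \<and> card (insert u B') \<le> card B"
      by (rule independent_span_bound[OF B(1)])
    moreover have "u \<notin> B'" using B'(1) uK by blast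
    ultimately have "finite B'" "card B' < card B" by auto
    then obtain bs where bs: "ordered_basis K bs" "\<And>v. v \<in> P \<inter> K \<Longrightarrow> lex_gt (coords bs) v 0"
      using less.hyps[OF _ \<open>total_cone K (P \<inter> K)\<close> _ B'(3)] by blast
    then have bs': "distinct bs" "independent (set bs)" "span (set bs) = K"
      by (auto simp: ordered_basis_def)
    have ind: "independent (set (u # bs))" using bs' uK by (simp add: independent_insert)
    have ubs: "u \<notin> set bs" using bs'(3) uK span_base by blast
    \<comment> \<open>The projection to the kernel along \<open>u\<close>.\<close>
    have dec: "v - f v *\<^sub>R u \<in> K" if "v \<in> L" for v
    proof -
      have "v + (- f v) *\<^sub>R u \<in> L" using that uL L by (intro subspace_add subspace_scale)
      moreover have "f (v + (- f v) *\<^sub>R u) = f v + (- f v) * f u"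
        using that uL by (simp only: f_add f_scale subspace_scale[OF L])
      ultimately show ?thesis using fu by (simp add: K_def)
    qed
    have sp: "span (set (u # bs)) = L"
    proof
      have "set (u # bs) \<subseteq> L" using uL bs'(3) \<open>K \<subseteq> L\<close> span_superset by fastforce
      then show "span (set (u # bs)) \<subseteq> L" using L span_minimal by blast
      show "L \<subseteq> span (set (u # bs))"
      proof
        fix v assume "v \<in> L"
        then have "v - f v *\<^sub>R u \<in> span (set bs)" using dec bs'(3) by simp
        then show "v \<in> span (set (u # bs))" by (auto simp: span_insert)
      qed
    qed
    have ob: "ordered_basis L (u # bs)"
      unfolding ordered_basis_def using ind sp ubs bs'(1) by simp
    \<comment> \<open>Vectors of \<open>K\<close> are already in the span of \<open>bs\<close>, so
      their representation is unaffected by prepending \<open>u\<close>.\<close>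
    have repK: "representation (set (u # bs)) v = representation (set bs) v" if "v \<in> K" for v
      using that bs'(3) by (intro representation_extend[OF ind]) auto
    \<comment> \<open>In \<open>v = (v - f v *\<^sub>R u) + f v *\<^sub>R u\<close> the first
      summand is in \<open>K\<close> and has coordinate 0 along \<open>u\<close>.\<close>
    have rep_u: "representation (set (u # bs)) v u = f v" if v: "v \<in> L" for v
    proof -
      have rK: "representation (set (u # bs)) (v - f v *\<^sub>R u) u = 0"
        using repK[OF dec[OF v]] ubs representation_ne_zero by metis
      have "representation (set (u # bs)) v
          = representation (set (u # bs)) ((v - f v *\<^sub>R u) + f v *\<^sub>R u)" by simp
      also have "\<dots> = (\<lambda>b. representation (set (u # bs)) (v - f v *\<^sub>R u) b
          + representation (set (u # bs)) (f v *\<^sub>R u) b)"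
        using dec[OF v] \<open>K \<subseteq> L\<close> uL subspace_scale[OF L]
        by (intro representation_add[OF ind]) (auto simp only: sp)
      also have "representation (set (u # bs)) (f v *\<^sub>R u)
          = (\<lambda>b. f v * representation (set (u # bs)) u b)"
        using uL by (intro representation_scale[OF ind]) (auto simp only: sp)
      also have "representation (set (u # bs)) u = (\<lambda>b. if b = u then 1 else 0)"
        by (intro representation_basis[OF ind]) simp
      finally show ?thesis using rK by simp
    qed
    have "lex_gt (coords (u # bs)) v 0" if v: "v \<in> P" for v
    proof -
      have vL: "v \<in> L" using v PL by blast
      have ru: "representation (set (u # bs)) v u = f v" "representation (set (u # bs)) 0 u = 0"
        using rep_u vL by (auto simp: representation_zero)
      show ?thesis
      proof (cases "f v = 0")
        case False
        then have "f v > 0" using f0[OF v] by simp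
        then show ?thesis using ru by (simp add: lex_gt_Cons)
      next
        case True
        then have vK: "v \<in> K" using vL by (simp add: K_def)
        then have "lex_gt (coords bs) v 0" using bs(2) v by blast
        moreover have "lex_gt (map (\<lambda>b v. representation (set (u # bs)) v b) bs) v 0
            \<longleftrightarrow> lex_gt (coords bs) v 0"
          using repK[OF vK] repK[OF subspace_0[OF K]] by (intro lex_gt_map_cong) simp
        ultimately show ?thesis using ru True by (simp add: lex_gt_Cons)
      qed
    qed
    then show ?thesis using ob by blast
  qed
qed

section \<open>Linearity of coordinates and convexity of the lexicographically positive set\<close>

lemma coords_linear:
  assumes "ordered_basis L bs" "x \<in> set (coords bs)" "a \<in> L" "b \<in> L"
  shows "x (a - b) = x a - x b" "x (s *\<^sub>R a + t *\<^sub>R b) = s * x a + t * x b" "x 0 = 0"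
proof -
  have ind: "independent (set bs)" and sp: "span (set bs) = L"
    using assms(1) by (auto simp: ordered_basis_def)
  obtain e where x: "x = (\<lambda>v. representation (set bs) v e)" using assms(2) by auto
  have ab: "a \<in> span (set bs)" "b \<in> span (set bs)" using assms(3,4) sp by auto
  show "x (a - b) = x a - x b"
    using ab by (simp add: x representation_diff[OF ind])
  show "x (s *\<^sub>R a + t *\<^sub>R b) = s * x a + t * x b"
    using ab by (simp add: x representation_add[OF ind] representation_scale[OF ind] span_scale)
  show "x 0 = 0" by (simp add: x representation_zero)
qed

lemma lex_gt_diff_iff:
  assumes "ordered_basis L bs" "a \<in> L" "b \<in> L"
  shows "lex_gt (coords bs) (a - b) 0 \<longleftrightarrow> lex_gt (coords bs) a b"
proof (rule lex_gt_cong)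
  fix x assume "x \<in> set (coords bs)"
  note coords_linear(1,3)[OF assms(1) this assms(2,3)]
  then show "x (a - b) - x 0 = x a - x b" by simp
qed

text \<open>Makes the hull condition necessary: for an induced order this set contains the positive
  part and omits the origin, so the convex hull omits it too.\<close>

lemma convex_lex_positive:
  assumes "ordered_basis L bs"
  shows "convex {v \<in> L. lex_gt (coords bs) v 0}"
proof (rule convexI)
  fix x y and s t :: real
  assume *: "x \<in> {v \<in> L. lex_gt (coords bs) v 0}" "y \<in> {v \<in> L. lex_gt (coords bs) v 0}"
    "s \<ge> 0" "t \<ge> 0" "s + t = 1"
  have L: "subspace L" using assms by (auto simp: ordered_basis_def)
  have "lex_gt (coords bs) (s *\<^sub>R x + t *\<^sub>R y) 0"
  proof (rule lex_gt_convex_combination[OF *(3-5), where a = x and b = y])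
    show "f 0 = 0 \<and> f (s *\<^sub>R x + t *\<^sub>R y) = s * f x + t * f y" if "f \<in> set (coords bs)" for f
      using coords_linear(2,3)[OF assms that] *(1,2) by blast
  qed (use * in auto)
  then show "s *\<^sub>R x + t *\<^sub>R y \<in> {v \<in> L. lex_gt (coords bs) v 0}"
    using * L by (simp add: subspace_add subspace_scale)
qed

theorem theorem26:
  fixes L G :: "'a::real_vector set"
    and gt :: "'a \<Rightarrow> 'a \<Rightarrow> bool"
  assumes "finite_dim_subspace L"
    and "add_subgroup G"
    and "G \<subseteq> L"
    and "strict_total_order_on G gt"
    and "add_compatible_on G gt"
  shows "(\<exists>xs. coordinate_system L xs \<and> induced_on G gt (lex_gt xs))
     \<longleftrightarrow> 0 \<notin> convex hull (positive_part G gt)"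
proof
  assume "\<exists>xs. coordinate_system L xs \<and> induced_on G gt (lex_gt xs)"
  then obtain bs where bs: "ordered_basis L bs" and ind: "induced_on G gt (lex_gt (coords bs))"
    by (auto simp: coordinate_system_def)
  have "positive_part G gt \<subseteq> {v \<in> L. lex_gt (coords bs) v 0}"
  proof
    fix v assume v: "v \<in> positive_part G gt"
    moreover have "0 \<in> G" using assms(2) by (simp add: add_subgroup_def)
    ultimately have "v \<in> G" "lex_gt (coords bs) v 0"
      using ind unfolding positive_part_def induced_on_def by auto
    then show "v \<in> {v \<in> L. lex_gt (coords bs) v 0}" using assms(3) by auto
  qed
  then have "convex hull (positive_part G gt) \<subseteq> {v \<in> L. lex_gt (coords bs) v 0}"
    using convex_lex_positive[OF bs] by (rule hull_minimal)
  moreover have "\<not> lex_gt (coords bs) 0 0" using lex_gt_asym by metis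
  ultimately show "0 \<notin> convex hull (positive_part G gt)" by auto
next
  assume nz: "0 \<notin> convex hull (positive_part G gt)"
  have L: "subspace L" and "\<exists>B. finite B \<and> span B = L"
    using assms(1) by (auto simp: finite_dim_subspace_def)
  then obtain B where B: "finite B" "span B = L" by blast
  have "convex hull (positive_part G gt) \<subseteq> L"
    using assms(3) by (intro hull_minimal subspace_imp_convex[OF L]) (auto simp: positive_part_def)
  then obtain P where P: "total_cone L P" "convex hull (positive_part G gt) \<subseteq> P"
    using total_cone_extension[OF L convex_convex_hull nz] by blast
  obtain bs where bs: "ordered_basis L bs" "\<And>v. v \<in> P \<Longrightarrow> lex_gt (coords bs) v 0"
    using total_cone_lex_basis[OF P(1) B] by blast
  \<comment> \<open>Translation by \<open>- b\<close> turns \<open>gt a b\<close> into positivity of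
    \<open>a - b\<close>, which then lies in the hull and so in \<open>P\<close>.\<close>
  have gt_lex: "lex_gt (coords bs) a b" if ab: "a \<in> G" "b \<in> G" "gt a b" for a b
  proof -
    have b: "- b \<in> G" using ab(2) assms(2) by (simp add: add_subgroup_def)
    then have "a + - b \<in> G" using ab(1) assms(2) by (simp only: add_subgroup_def)
    moreover have "gt (a + - b) (b + - b)"
      using ab b assms(5) by (simp only: add_compatible_on_def)
    ultimately have "a - b \<in> positive_part G gt" by (simp add: positive_part_def)
    then have "a - b \<in> P" using P(2) by (meson hull_inc subsetD)
    then have "lex_gt (coords bs) (a - b) 0" by (rule bs(2))
    moreover have "a \<in> L" "b \<in> L" using ab(1,2) assms(3) by auto
    ultimately show ?thesis using lex_gt_diff_iff[OF bs(1)] by simp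
  qed
  \<comment> \<open>The converse comes from totality of \<open>gt\<close>: by \<open>gt_lex\<close>
    and asymmetry of the lexicographic order, \<open>a = b\<close> and \<open>gt b a\<close> are
    impossible.\<close>
  have "gt a b" if ab: "a \<in> G" "b \<in> G" "lex_gt (coords bs) a b" for a b
  proof -
    have "\<not> lex_gt (coords bs) b a" using ab(3) by (rule lex_gt_asym)
    then have "a \<noteq> b" "\<not> gt b a" using ab gt_lex by auto
    then show ?thesis
      using assms(4) ab(1,2) by (auto simp: strict_total_order_on_def totalp_on_def)
  qed
  then have "induced_on G gt (lex_gt (coords bs))" using gt_lex by (auto simp only: induced_on_def)
  moreover have "coordinate_system L (coords bs)"
    unfolding coordinate_system_def using bs(1) by (intro exI[of _ bs]) simp
  ultimately show "\<exists>xs. coordinate_system L xs \<and> induced_on G gt (lex_gt xs)"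
    by (intro exI conjI)
qed

end
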